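(* Let $G$ be a Polish group and let $m$ be a continuous partial action of $G$ on a Polish space $X$. Let $x\in X$ be such that $G^x$ is $G_\delta$ in $G$ and $G_x$ is closed in $G$. Consider the following assertions. (1) The map $\phi\colon G^x/G_x\to G^x\cdot x$, $gG_x\mapsto g\cdot x$, is a homeomorphism. (2) $G^x\cdot x$ is $G_\delta$ in $X$. (3) $G^x\cdot x$ is not meager in its relative topology. Then $(1)\Rightarrow(2)\Rightarrow(3)$. Moreover, if $G^x$ is open in $G$, then all three assertions are equivalent.
   Context: A partial action of a group $G$ (identity $1$) on a set $X$ is a partially defined function $m\colon G\times X\to X$, $(g,x)\mapsto g\cdot x$, such that, writing $\exists\, g\cdot x$ for "$(g,x)$ is in the domain of $m$", for all $g,h\in G$ and $x\in X$: (PA1) $\exists\, g\cdot x$ implies $\exists\, g^{-1}\cdot(g\cdot x)$ and $g^{-1}\cdot(g\cdot x)=x$; (PA2) $\exists\, g\cdot(h\cdot x)$ implies $\exists\,(gh)\cdot x$ and $g\cdot(h\cdot x)=(gh)\cdot x$; (PA3) $\exists\, 1\cdot x$ and $1\cdot x=x$. Notation: $G*X=\{(g,x)\in G\times X: \exists\, g\cdot x\}$ is the domain of $m$; $X_{g^{-1}}=\{x\in X:\exists\, g\cdot x\}$; $m_g\colon X_{g^{-1}}\to X_g$, $x\mapsto g\cdot x$ (a bijection); $G^x=\{g\in G:\exists\, g\cdot x\}$, with the subspace topology; the orbit of $x$ is $G^x\cdot x=\{g\cdot x: g\in G^x\}$, with the subspace topology from $X$; the stabilizer of $x$ is $G_x=\{g\in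 G^x: g\cdot x=x\}$, a subgroup of $G$ (and $gG_x\subseteq G^x$ for $g\in G^x$). $G^x/G_x=\{gG_x: g\in G^x\}$ carries the quotient topology induced by the map $G^x\to G^x/G_x$, $g\mapsto gG_x$. When $G$ is a topological group and $X$ a topological space, $m$ is a continuous partial action if each $X_g$ is open in $X$, each $m_g\colon X_{g^{-1}}\to X_g$ is a homeomorphism, and $m\colon G*X\to X$ is continuous, where $G*X$ has the topology induced from the product $G\times X$. A Polish space is a separable completely metrizable topological space; a Polish group is a topological group whose topology is Polish. *)

theory Defs
  imports "HOL-Analysis.Analysis" "HOL-Algebra.Coset"
begin

section \<open>Topological preliminaries\<close>

definition polish_topology :: "'a topology \<Rightarrow> bool" where
  "polish_topology X \<longleftrightarrow> separable_space X \<and> completely_metrizable_space X"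

definition nowhere_dense_in :: "'a topology \<Rightarrow> 'a set \<Rightarrow> bool" where
  "nowhere_dense_in X N \<longleftrightarrow> N \<subseteq> topspace X \<and> X interior_of (X closure_of N) = {}"

definition meager_in :: "'a topology \<Rightarrow> 'a set \<Rightarrow> bool" where
  "meager_in X S \<longleftrightarrow> (\<exists>\<N>. countable \<N> \<and> (\<forall>N\<in>\<N>. nowhere_dense_in X N) \<and> S = \<Union>\<N>)"

definition quotient_topology :: "'a topology \<Rightarrow> ('a \<Rightarrow> 'b) \<Rightarrow> 'b topology" where
  "quotient_topology X f =
     topology (\<lambda>U. U \<subseteq> f ` topspace X \<and> openin X {x \<in> topspace X. f x \<in> U})"

lemma openin_quotient_topology:
  "openin (quotient_topology X f) U \<longleftrightarrow>
     U \<subseteq> f ` topspace X \<and> openin X {x \<in> topspace X. f x \<in> U}"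
proof -
  have "istopology (\<lambda>U. U \<subseteq> f ` topspace X \<and> openin X {x \<in> topspace X. f x \<in> U})"
    unfolding istopology_def
  proof (intro conjI allI impI)
    fix S T
    assume "S \<subseteq> f ` topspace X \<and> openin X {x \<in> topspace X. f x \<in> S}"
      and "T \<subseteq> f ` topspace X \<and> openin X {x \<in> topspace X. f x \<in> T}"
    moreover have "{x \<in> topspace X. f x \<in> S \<inter> T}
        = {x \<in> topspace X. f x \<in> S} \<inter> {x \<in> topspace X. f x \<in> T}"
      by auto
    ultimately show "S \<inter> T \<subseteq> f ` topspace X" "openin X {x \<in> topspace X. f x \<in> S \<inter> T}"
      by auto
  next
    fix \<K>
    assume *: "\<forall>K\<in>\<K>. K \<subseteq> f ` topspace X \<and> openin X {x \<in> topspace X. f x \<in> K}"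
    then show "\<Union>\<K> \<subseteq> f ` topspace X"
      by blast
    have "{x \<in> topspace X. f x \<in> \<Union>\<K>} = (\<Union>K\<in>\<K>. {x \<in> topspace X. f x \<in> K})"
      by auto
    with * show "openin X {x \<in> topspace X. f x \<in> \<Union>\<K>}"
      by auto
  qed
  then show ?thesis
    by (simp add: quotient_topology_def topology_inverse')
qed

lemma topspace_quotient_topology: "topspace (quotient_topology X f) = f ` topspace X"
proof -
  have "{x \<in> topspace X. f x \<in> f ` topspace X} = topspace X"
    by auto
  then have "openin (quotient_topology X f) (f ` topspace X)"
    by (simp add: openin_quotient_topology)
  then have "f ` topspace X \<subseteq> topspace (quotient_topology X f)"
    by (rule openin_subset)
  moreover have "topspace (quotient_topology X f) \<subseteq> f ` topspace X"
    using openin_topspace[of "quotient_topology X f"] unfolding openin_quotient_topology by (rule conjunct1)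
  ultimately show ?thesis
    by (rule subset_antisym[rotated])
qed

lemma quotient_map_quotient_topology: "quotient_map X (quotient_topology X f) f"
  by (simp add: quotient_map_def topspace_quotient_topology openin_quotient_topology)


section \<open>Polish groups\<close>

locale topological_group_on = group G for G (structure) +
  fixes T
  assumes topspace_eq: "topspace T = carrier G"
    and continuous_mult: "continuous_map (prod_topology T T) T (\<lambda>(g, h). g \<otimes> h)"
    and continuous_inv: "continuous_map T T (\<lambda>g. inv g)"

definition polish_group :: "('g, 'b) monoid_scheme \<Rightarrow> 'g topology \<Rightarrow> bool" where
  "polish_group G T \<longleftrightarrow> topological_group_on G T \<and> polish_topology T"


section \<open>Partial actions\<close>

text \<open>
  The partially defined function is an option-valued function \<open>m\<close>: the statement
  ``\<open>g \<cdot> x\<close> exists'' is \<open>m g x \<noteq> None\<close>, and \<open>m g x = Some y\<close> says that it exists and equals \<open>y\<close>.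
  It is undefined outside of \<open>carrier G \<times> X\<close>.
\<close>

locale partial_action = group G for G (structure) +
  fixes X :: "'x set" and m :: "'a \<Rightarrow> 'x \<Rightarrow> 'x option"
  assumes defined_only: "m g x = Some y \<Longrightarrow> g \<in> carrier G \<and> x \<in> X \<and> y \<in> X"
    and PA1: "m g x = Some y \<Longrightarrow> m (inv g) y = Some x"
    and PA2: "m h x = Some y \<Longrightarrow> m g y = Some z \<Longrightarrow> m (g \<otimes> h) x = Some z"
    and PA3: "x \<in> X \<Longrightarrow> m \<one> x = Some x"

definition pa_dom :: "('g \<Rightarrow> 'x \<Rightarrow> 'x option) \<Rightarrow> ('g \<times> 'x) set" where
  "pa_dom m = {(g, x). m g x \<noteq> None}"

text \<open>\<open>pa_source m g\<close> is the domain of \<open>m\<^sub>g\<close>, i.e. the set written \<open>X\<close> with index \<open>g\<^sup>-\<^sup>1\<close>; hence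
  \<open>X\<^sub>g\<close> is \<open>pa_source m (inv g)\<close>.\<close>

definition pa_source :: "('g \<Rightarrow> 'x \<Rightarrow> 'x option) \<Rightarrow> 'g \<Rightarrow> 'x set" where
  "pa_source m g = {x. m g x \<noteq> None}"

definition pa_act :: "('g \<Rightarrow> 'x \<Rightarrow> 'x option) \<Rightarrow> 'g \<Rightarrow> 'x \<Rightarrow> 'x" where
  "pa_act m g x = the (m g x)"

text \<open>\<open>pa_at m x\<close> is \<open>G\<^sup>x\<close>, and \<open>pa_stabilizer m x\<close> is \<open>G\<^sub>x\<close>.\<close>

definition pa_at :: "('g \<Rightarrow> 'x \<Rightarrow> 'x option) \<Rightarrow> 'x \<Rightarrow> 'g set" where
  "pa_at m x = {g. m g x \<noteq> None}"

definition pa_orbit :: "('g \<Rightarrow> 'x \<Rightarrow> 'x option) \<Rightarrow> 'x \<Rightarrow> 'x set" where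
  "pa_orbit m x = (\<lambda>g. pa_act m g x) ` pa_at m x"

definition pa_stabilizer :: "('g \<Rightarrow> 'x \<Rightarrow> 'x option) \<Rightarrow> 'x \<Rightarrow> 'g set" where
  "pa_stabilizer m x = {g \<in> pa_at m x. pa_act m g x = x}"

locale continuous_partial_action =
  topological_group_on G TG + partial_action G "topspace TX" m
  for G (structure) and TG and TX :: "'x topology" and m +
  assumes open_source: "g \<in> carrier G \<Longrightarrow> openin TX (pa_source m (inv g))"
    and homeomorphic_act: "g \<in> carrier G \<Longrightarrow>
      homeomorphic_map (subtopology TX (pa_source m g)) (subtopology TX (pa_source m (inv g)))
        (pa_act m g)"
    and continuous_act:
      "continuous_map (subtopology (prod_topology TG TX) (pa_dom m)) TX (\<lambda>(g, x). pa_act m g x)"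

definition pa_coset_topology ::
  "('g, 'b) monoid_scheme \<Rightarrow> 'g topology \<Rightarrow> ('g \<Rightarrow> 'x \<Rightarrow> 'x option) \<Rightarrow> 'x \<Rightarrow> 'g set topology" where
  "pa_coset_topology G TG m x =
     quotient_topology (subtopology TG (pa_at m x)) (\<lambda>g. g <#\<^bsub>G\<^esub> pa_stabilizer m x)"

text \<open>The map \<open>g G\<^sub>x \<mapsto> g \<cdot> x\<close>; see \<open>pa_orbit_map_coset\<close> below for its being well defined.\<close>

definition pa_orbit_map ::
  "('g, 'b) monoid_scheme \<Rightarrow> ('g \<Rightarrow> 'x \<Rightarrow> 'x option) \<Rightarrow> 'x \<Rightarrow> 'g set \<Rightarrow> 'x" where
  "pa_orbit_map G m x C =
     (THE y. \<exists>g \<in> pa_at m x. C = g <#\<^bsub>G\<^esub> pa_stabilizer m x \<and> y = pa_act m g x)"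

context partial_action
begin

lemma act_stabilizer_coset:
  assumes g: "g \<in> pa_at m x" and h: "h \<in> g <# pa_stabilizer m x"
  shows "h \<in> pa_at m x \<and> pa_act m h x = pa_act m g x"
proof -
  from h obtain s where s: "s \<in> pa_stabilizer m x" "h = g \<otimes> s"
    by (auto simp: l_coset_def)
  from s have "m s x = Some x"
    by (auto simp: pa_stabilizer_def pa_at_def pa_act_def)
  moreover from g obtain y where "m g x = Some y"
    by (auto simp: pa_at_def)
  ultimately have "m h x = Some y" "m g x = Some y"
    using PA2[of s x x g y] s(2) by simp_all
  then show ?thesis
    by (simp add: pa_at_def pa_act_def)
qed

lemma pa_orbit_map_coset:
  assumes g: "g \<in> pa_at m x"
  shows "pa_orbit_map G m x (g <# pa_stabilizer m x) = pa_act m g x"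
  unfolding pa_orbit_map_def
proof (rule the_equality)
  show "\<exists>h\<in>pa_at m x. g <# pa_stabilizer m x = h <# pa_stabilizer m x \<and> pa_act m g x = pa_act m h x"
    using g by blast
next
  fix y
  assume "\<exists>h\<in>pa_at m x. g <# pa_stabilizer m x = h <# pa_stabilizer m x \<and> y = pa_act m h x"
  then obtain h where h: "h \<in> pa_at m x" "g <# pa_stabilizer m x = h <# pa_stabilizer m x"
    "y = pa_act m h x"
    by blast
  from g have gX: "g \<in> carrier G" "x \<in> X"
    by (auto simp: pa_at_def dest: defined_only)
  then have "\<one> \<in> pa_stabilizer m x"
    using PA3[of x] by (simp add: pa_stabilizer_def pa_at_def pa_act_def)
  then have "g \<otimes> \<one> \<in> g <# pa_stabilizer m x"
    unfolding l_coset_def by blast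
  then have "g \<in> h <# pa_stabilizer m x"
    using gX h by simp
  then show "y = pa_act m g x"
    using act_stabilizer_coset[OF h(1)] h(3) by simp
qed

end

end

theory Submission
  imports Defs
begin

text \<open>
  Write \<open>f\<close> for the map \<open>g \<mapsto> g \<cdot> x\<close> from \<open>G\<^sup>x\<close> onto the orbit. Since \<open>G\<^sup>x \<rightarrow> G\<^sup>x/G\<^sub>x\<close> is open, \<open>\<phi>\<close> is a
  homeomorphism iff \<open>f\<close> is open. In that case the orbit is an open continuous image of the Polish
  space \<open>G\<^sup>x\<close> inside a metrizable space, which forces it to be \<open>G\<^sub>\<delta>\<close> (Hausdorff). A \<open>G\<^sub>\<delta>\<close> orbit is
  completely metrizable, hence nonmeager by Baire's theorem. Finally, let the orbit be nonmeager and
  \<open>G\<^sup>x\<close> open. Countably many translates of \<open>W \<cdot> x\<close> cover the orbit for every neighbourhood \<open>W\<close> of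
  \<open>\<one>\<close>, so \<open>W \<cdot> x\<close> is dense in some open set and \<open>f\<close> is almost open: \<open>f(U)\<close> lies in the interior
  of its closure. As in the Banach open mapping theorem, completeness of \<open>G\<close> upgrades this to
  openness: if \<open>k \<cdot> x\<close> lies in the interior of the closure of \<open>f(U)\<close>, alternately moving points of \<open>U\<close>
  and points close to \<open>k\<close> gives in the limit \<open>h \<cdot> x = k' \<cdot> x\<close> with \<open>h \<in> U\<close> and \<open>k'\<close> close to \<open>k\<close>, so
  that \<open>k \<cdot> x = (k k'\<^sup>-\<^sup>1 h) \<cdot> x\<close>.
\<close>

no_notation eq_closure_of (\<open>closure'_of\<index>\<close>)

section \<open>Complete metric spaces\<close>

text \<open>A closed ball is wanted so that closures of sets inside it stay in \<open>U\<close>; the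
  bound \<open>e\<close> supplies the shrinking radii.\<close>

lemma (in Metric_space) openin_small_ball:
  assumes "openin mtopology U" "p \<in> U" "0 < e"
  obtains s where "0 < s" "s \<le> e" "mcball p s \<subseteq> U"
proof -
  obtain r where r: "r > 0" "mcball p r \<subseteq> U"
    using assms(1,2) unfolding openin_mtopology_mcball by blast
  show thesis
    using r assms(3) mcball_subset_concentric[of "min r e" r p] by (intro that[of "min r e"]) auto
qed

text \<open>Cantor's intersection theorem for the closures. As each closure lies in the preceding
  set, the common point lies in every \<open>U n\<close>; the shrinking radii then put some
  \<open>U n\<close> into any neighbourhood of it.\<close>

lemma (in Metric_space) complete_nest_point:
  assumes "mcomplete" and ne: "\<And>n. U n \<noteq> {}"
    and nest: "\<And>n. mtopology closure_of U (Suc n) \<subseteq> U n"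
    and small: "\<And>n. \<exists>c. U n \<subseteq> mcball c (inverse (Suc n))"
    and sub: "\<And>n. U n \<subseteq> M"
  obtains p where "\<And>n. p \<in> U n" "\<And>V. openin mtopology V \<Longrightarrow> p \<in> V \<Longrightarrow> \<exists>n. U n \<subseteq> V"
proof -
  let ?C = "\<lambda>n. mtopology closure_of U n"
  have incl: "U n \<subseteq> ?C n" for n
    using sub by (simp add: closure_of_subset)
  have "decseq ?C"
    by (rule decseq_SucI) (rule subset_trans[OF nest incl])
  moreover have closed_small: "\<exists>n a. ?C n \<subseteq> mcball a \<epsilon>" if \<epsilon>: "\<epsilon> > 0" for \<epsilon>
  proof -
    obtain n where "inverse (Suc n) < \<epsilon>"
      using reals_Archimedean[OF \<epsilon>] by blast
    moreover obtain c where "U n \<subseteq> mcball c (inverse (Suc n))"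
      using small by blast
    ultimately have "U n \<subseteq> mcball c \<epsilon>"
      using mcball_subset_concentric[of "inverse (Suc n)" \<epsilon> c] by auto
    then show ?thesis
      by (meson closedin_mcball closure_of_minimal)
  qed
  moreover have "\<And>n. ?C n \<noteq> {}"
    using ne incl by (metis subset_empty)
  ultimately have "\<Inter> (range ?C) \<noteq> {}"
    using \<open>mcomplete\<close> unfolding mcomplete_nest by (metis closedin_closure_of)
  then obtain p where p: "\<And>n. p \<in> ?C n"
    by auto
  have pU: "p \<in> U n" for n
    using nest p by (rule subsetD)
  show thesis
  proof
    fix V assume "openin mtopology V" "p \<in> V"
    then obtain r where r: "r > 0" "mball p r \<subseteq> V"
      by (auto simp: openin_mtopology)
    \<comment> \<open>Two points of a ball of radius \<open>r/3\<close> are at distance at most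
      \<open>2 * r/3\<close>, strictly below \<open>r\<close>.\<close>
    then obtain n a where na: "?C n \<subseteq> mcball a (r/3)"
      using closed_small[of "r/3"] by auto
    have "z \<in> mball p r" if "z \<in> U n" for z
    proof -
      have "z \<in> mcball a (r/3)" "p \<in> mcball a (r/3)"
        using na incl[of n] that p[of n] by auto
      then have "d p z \<le> r/3 + r/3" "p \<in> M" "z \<in> M"
        using triangle[of p a z] by (auto simp: commute)
      then show ?thesis
        using r by simp
    qed
    then show "\<exists>n. U n \<subseteq> V"
      using r by blast
  qed (rule pU)
qed

lemma (in Metric_space) separable_imp_second_countable:
  assumes "separable_space mtopology"
  shows "second_countable mtopology"
proof -
  obtain C where C: "countable C" "C \<subseteq> M" "mtopology closure_of C = M"
    using assms by (auto simp: separable_space_def)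
  let ?B = "(\<lambda>(c, n::nat). mball c (inverse (Suc n))) ` (C \<times> UNIV)"
  have "\<exists>V\<in>?B. x \<in> V \<and> V \<subseteq> U" if "openin mtopology U" "x \<in> U" for U x
  proof -
    have x: "x \<in> M" and "\<exists>r>0. mball x r \<subseteq> U"
      using that by (auto simp: openin_mtopology)
    then obtain r where r: "r > 0" "mball x r \<subseteq> U"
      by blast
    obtain n where n: "inverse (Suc n) < r/2"
      using reals_Archimedean[of "r/2"] r by auto
    obtain c where c: "c \<in> C" "d x c < inverse (Suc n)"
    proof -
      have "x \<in> mtopology closure_of C" "inverse (real (Suc n)) > 0"
        using x C(3) by auto
      then have "\<exists>c\<in>C. c \<in> mball x (inverse (Suc n))"
        unfolding metric_closure_of by blast
      then show ?thesis
        using that by auto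
    qed
    have "d c x + inverse (real (Suc n)) \<le> r"
      using c n commute[of x c] by linarith
    then have "mball c (inverse (Suc n)) \<subseteq> mball x r"
      using x by (rule mball_subset)
    moreover have "x \<in> mball c (inverse (Suc n))"
      using c x C(2) commute[of x c] unfolding in_mball by auto
    moreover have "mball c (inverse (Suc n)) \<in> ?B"
      using c by blast
    ultimately show ?thesis
      using r(2) by (meson subset_trans)
  qed
  moreover have "countable ?B"
    using C by simp
  ultimately show ?thesis
    unfolding second_countable_def by (intro exI[of _ ?B]) auto
qed

section \<open>Open continuous images of Polish spaces\<close>

lemma polish_imp_second_countable:
  "polish_topology X \<Longrightarrow> second_countable X"
  unfolding polish_topology_def completely_metrizable_space_def
  by (metis Metric_space.separable_imp_second_countable)

text \<open>
  Choose \<open>V U\<close> open in \<open>X\<close> with trace \<open>f ` U\<close> on the image. Membership in the \<open>G\<^sub>\<delta>\<close> sets \<open>R n U\<close> says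
  that a point of \<open>V U\<close> lies in \<open>V U'\<close> for some small basic \<open>U'\<close> inside \<open>U\<close>; iterating this,
  the \<open>U\<close>'s shrink to a preimage of the point.
\<close>

lemma gdelta_in_open_map_image:
  assumes P: "completely_metrizable_space P" "second_countable P"
    and X: "metrizable_space X"
    and f: "continuous_map P X f" "open_map P (subtopology X (f ` topspace P)) f"
  shows "gdelta_in X (f ` topspace P)"
proof -
  obtain M d where M: "Metric_space M d" "Metric_space.mcomplete M d" and Peq: "P = Metric_space.mtopology M d"
    using P unfolding completely_metrizable_space_def by blast
  interpret Metric_space M d by fact
  let ?Y = "f ` M"
  obtain \<B> where \<B>: "countable \<B>" "\<And>V. V \<in> \<B> \<Longrightarrow> openin mtopology V"
    and base: "\<And>U x. openin mtopology U \<Longrightarrow> x \<in> U \<Longrightarrow> \<exists>V\<in>\<B>. x \<in> V \<and> V \<subseteq> U"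
    using P unfolding second_countable_def Peq by meson
  have fim: "?Y \<subseteq> topspace X"
    using f(1) Peq by (auto simp: continuous_map_def)
  have "\<exists>V. openin X V \<and> f ` U = V \<inter> ?Y" if "openin mtopology U" for U
    using f(2) that unfolding open_map_def Peq openin_subtopology by auto
  then obtain V where V: "\<And>U. openin mtopology U \<Longrightarrow> openin X (V U)"
    and VY: "\<And>U. openin mtopology U \<Longrightarrow> f ` U = V U \<inter> ?Y"
    by metis
  \<comment> \<open>\<open>N n U\<close> holds the admissible successors of \<open>U\<close>: their
    closures stay in \<open>U\<close>, as \<open>complete_nest_point\<close> requires, and their
    radii shrink with \<open>n\<close>.\<close>
  define N where "N n U = {U' \<in> \<B>. mtopology closure_of U' \<subseteq> U \<and> (\<exists>c. U' \<subseteq> mcball c (inverse (Suc n)))}"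
    for n U
  have N_cover: "\<exists>U'\<in>N n U. p \<in> U'" if U: "openin mtopology U" "p \<in> U" for n U p
  proof -
    obtain s where s: "s > 0" "s \<le> inverse (Suc n)" "mcball p s \<subseteq> U"
      using openin_small_ball[OF U, of "inverse (Suc n)"] by auto
    have "p \<in> M"
      using openin_subset[OF \<open>openin mtopology U\<close>] \<open>p \<in> U\<close> by auto
    then obtain U' where U': "U' \<in> \<B>" "p \<in> U'" "U' \<subseteq> mball p s"
      using base[of "mball p s" p] s(1) by auto
    then have sub: "U' \<subseteq> mcball p s"
      using mball_subset_mcball by blast
    then have "mtopology closure_of U' \<subseteq> U"
      using s(3) by (meson closedin_mcball closure_of_minimal subset_trans)
    moreover have "U' \<subseteq> mcball p (inverse (Suc n))"
      using sub mcball_subset_concentric[OF s(2)] by blast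
    ultimately show ?thesis
      using U' unfolding N_def by blast
  qed
  define R where "R n U = (topspace X - V U) \<union> (\<Union>U'\<in>N n U. V U')" for n U
  have N_open: "openin mtopology U'" if "U' \<in> N n U" for n U U'
    using that \<B> by (auto simp: N_def)
  have "gdelta_in X (R n U)" if "openin mtopology U" for n U
  proof -
    have "closedin X (topspace X - V U)"
      using V that by blast
    moreover have "openin X (\<Union>U'\<in>N n U. V U')"
      using V N_open by blast
    ultimately show ?thesis
      unfolding R_def by (intro gdelta_in_Un open_imp_gdelta_in closed_imp_gdelta_in X)
  qed
  moreover have "openin mtopology M"
    by (metis openin_topspace topspace_mtopology)
  ultimately have "gdelta_in X (\<Inter>(n, U)\<in>UNIV \<times> insert M \<B>. R n U)"
    using \<B> by (intro gdelta_in_Inter) auto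
  moreover have "gdelta_in X (V M \<inter> X closure_of ?Y)"
    using \<open>openin mtopology M\<close> V
    by (intro gdelta_in_Int open_imp_gdelta_in closed_imp_gdelta_in X) auto
  ultimately have W: "gdelta_in X ((V M \<inter> X closure_of ?Y) \<inter> (\<Inter>(n, U)\<in>UNIV \<times> insert M \<B>. R n U))"
    by (rule gdelta_in_Int[rotated])
  \<comment> \<open>\<open>V M\<close> and the index \<open>M\<close> start the chain. The closure
    of \<open>?Y\<close> enters because \<open>V U\<close> is prescribed only on \<open>?Y\<close>:
    if \<open>V U\<close> contains a point of the closure, it meets \<open>?Y\<close> arbitrarily
    near that point.\<close>
  have "?Y = (V M \<inter> X closure_of ?Y) \<inter> (\<Inter>(n, U)\<in>UNIV \<times> insert M \<B>. R n U)" (is "_ = ?W")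
  proof
    have R: "y \<in> R n U" if U: "openin mtopology U" "y \<in> ?Y" for n U y
    proof (cases "y \<in> V U")
      case True
      then have "y \<in> f ` U"
        using VY[OF U(1)] U(2) by blast
      then obtain p where p: "p \<in> U" "y = f p"
        by blast
      obtain U' where U': "U' \<in> N n U" "p \<in> U'"
        using N_cover[OF U(1) p(1)] by blast
      then have "y \<in> V U'"
        using VY[OF N_open[OF U'(1)]] p(2) by blast
      then show ?thesis
        using U'(1) unfolding R_def by blast
    qed (use that fim in \<open>auto simp: R_def\<close>)
    show "?Y \<subseteq> ?W"
    proof
      fix y assume y: "y \<in> ?Y"
      have "openin mtopology U" if "U \<in> insert M \<B>" for U
        using that \<B>(2) \<open>openin mtopology M\<close> by auto
      then have "y \<in> R n U" if "U \<in> insert M \<B>" for n U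
        using R[OF _ y] that by metis
      moreover have "y \<in> V M" "y \<in> X closure_of ?Y"
        using VY[OF \<open>openin mtopology M\<close>] closure_of_subset[OF fim] y by (metis IntE, metis subsetD)
      ultimately show "y \<in> ?W"
        by simp
    qed
  next
    show "?W \<subseteq> ?Y"
    proof
      fix y assume y: "y \<in> ?W"
      then have yM: "y \<in> V M" and y_cl: "y \<in> X closure_of ?Y"
        by simp_all
      have step: "\<exists>U'. U' \<in> N n U \<and> y \<in> V U'" if "U \<in> insert M \<B>" "y \<in> V U" for n U
      proof -
        have "y \<in> R n U"
          using y that(1) by auto
        then show ?thesis
          using that(2) by (auto simp: R_def)
      qed
      have "\<exists>U. \<forall>n. (U n \<in> \<B> \<and> y \<in> V (U n) \<and> (\<exists>c. U n \<subseteq> mcball c (inverse (Suc n))))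
              \<and> U (Suc n) \<in> N (Suc n) (U n)"
      proof (rule dependent_nat_choice)
        show "\<exists>U. U \<in> \<B> \<and> y \<in> V U \<and> (\<exists>c. U \<subseteq> mcball c (inverse (Suc 0)))"
          using step[of M 0] yM by (auto simp: N_def)
      next
        fix U n assume "U \<in> \<B> \<and> y \<in> V U \<and> (\<exists>c. U \<subseteq> mcball c (inverse (Suc n)))"
        then show "\<exists>U'. (U' \<in> \<B> \<and> y \<in> V U' \<and> (\<exists>c. U' \<subseteq> mcball c (inverse (Suc (Suc n)))))
            \<and> U' \<in> N (Suc n) U"
          using step[of U "Suc n"] by (auto simp: N_def)
      qed
      then obtain U where U: "\<And>n. U n \<in> \<B>" "\<And>n. y \<in> V (U n)"
        "\<And>n. \<exists>c. U n \<subseteq> mcball c (inverse (Suc n))" "\<And>n. U (Suc n) \<in> N (Suc n) (U n)"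
        by blast
      \<comment> \<open>\<open>Q \<inter> V (U n)\<close> is a neighbourhood of \<open>y\<close>, so
        it meets \<open>?Y\<close>, and within \<open>?Y\<close> the set \<open>V (U n)\<close> is
        the image of \<open>U n\<close>.\<close>
      have hit: "Q \<inter> f ` U n \<noteq> {}" if "openin X Q" "y \<in> Q" for Q n
      proof -
        have "openin X (Q \<inter> V (U n))"
          using V[OF \<B>(2)[OF U(1)]] that(1) by blast
        moreover have "y \<in> Q \<inter> V (U n)"
          using U(2) that(2) by blast
        ultimately have "Q \<inter> V (U n) \<inter> ?Y \<noteq> {}"
          using y_cl unfolding in_closure_of by blast
        then show ?thesis
          unfolding VY[OF \<B>(2)[OF U(1)[of n]]] by (simp add: Int_assoc)
      qed
      have y_X: "y \<in> topspace X"
        using y_cl by (simp add: in_closure_of)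
      obtain p where p: "\<And>n. p \<in> U n"
        "\<And>W. openin mtopology W \<Longrightarrow> p \<in> W \<Longrightarrow> \<exists>n. U n \<subseteq> W"
      proof (rule complete_nest_point[of U])
        show "U n \<noteq> {}" for n
          using hit[of "topspace X" n] y_X by auto
        show "mtopology closure_of U (Suc n) \<subseteq> U n" for n
          using U(4)[of n] by (auto simp: N_def)
        show "U n \<subseteq> M" for n
          using \<B>(2)[OF U(1)[of n]] openin_subset topspace_mtopology by blast
      qed (use M U(3) in auto)
      have "p \<in> M"
        using p(1)[of 0] \<B>(2)[OF U(1)[of 0]] openin_subset topspace_mtopology by blast
      \<comment> \<open>By continuity some \<open>U n\<close> maps into a given neighbourhood of
        \<open>f p\<close>, whereas its image meets every neighbourhood of \<open>y\<close>; in a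
        Hausdorff space this forces equality.\<close>
      have "f p = y"
      proof (rule ccontr)
        assume "f p \<noteq> y"
        moreover have "Hausdorff_space X"
          using X by (rule metrizable_imp_Hausdorff_space)
        moreover have "f p \<in> topspace X"
          using \<open>p \<in> M\<close> fim by blast
        ultimately obtain O1 O2 where O: "openin X O1" "openin X O2" "f p \<in> O1" "y \<in> O2" "disjnt O1 O2"
          using y_X unfolding Hausdorff_space_def by blast
        have "openin mtopology {q \<in> M. f q \<in> O1}"
          using f(1) O(1) unfolding Peq by (simp add: continuous_map_def)
        then obtain n where "U n \<subseteq> {q \<in> M. f q \<in> O1}"
          using p(2)[of "{q \<in> M. f q \<in> O1}"] \<open>p \<in> M\<close> O(3) by blast
        then show False
          using hit[OF O(2,4), of n] O(5) by (auto simp: disjnt_def)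
      qed
      then show "y \<in> ?Y"
        using \<open>p \<in> M\<close> by blast
    qed
  qed
  then have "gdelta_in X ?Y"
    by (rule ssubst) (rule W)
  then show ?thesis
    unfolding Peq topspace_mtopology .
qed

section \<open>Baire category and almost open maps\<close>

text \<open>Baire's theorem is applied to the closures of the pieces, which still have empty
  interior.\<close>

lemma not_meager_in_topspace:
  assumes "completely_metrizable_space X" "topspace X \<noteq> {}"
  shows "\<not> meager_in X (topspace X)"
proof
  assume "meager_in X (topspace X)"
  then obtain \<N> where N: "countable \<N>" "\<And>N. N \<in> \<N> \<Longrightarrow> nowhere_dense_in X N" "topspace X = \<Union>\<N>"
    by (auto simp: meager_in_def)
  have "X interior_of \<Union>((\<lambda>N. X closure_of N) ` \<N>) = {}"
    using N(1,2) assms(1) by (intro Baire_category_alt) (auto simp: nowhere_dense_in_def)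
  moreover have "topspace X \<subseteq> \<Union>((\<lambda>N. X closure_of N) ` \<N>)"
  proof -
    have "N \<subseteq> X closure_of N" if "N \<in> \<N>" for N
      using N(2)[OF that] by (simp add: nowhere_dense_in_def closure_of_subset)
    then show ?thesis
      unfolding N(3) by blast
  qed
  ultimately have "topspace X \<subseteq> {}"
    by (metis interior_of_maximal openin_topspace)
  then show False
    using assms(2) by blast
qed

text \<open>A zigzag: if \<open>f k\<close> with \<open>k\<close> in \<open>B\<close> is interior to
  the closure of the image of \<open>A\<close>, shrink \<open>B\<close> to a ball about
  \<open>k\<close>. Almost openness makes \<open>f k\<close> interior to the closure of the image of
  this ball, so some point of \<open>A\<close> maps into that interior, and the two sets have
  exchanged roles. Iterating shrinks both to points with the same image.\<close>

lemma almost_open_image_meets: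
  assumes P: "completely_metrizable_space P" and Y: "Hausdorff_space Y"
    and f: "continuous_map P Y f"
    and almost: "\<And>U. openin P U \<Longrightarrow> f ` U \<subseteq> Y interior_of (Y closure_of (f ` U))"
    and A: "openin P A" and B: "openin P B"
    and meet: "f ` B \<inter> Y interior_of (Y closure_of (f ` A)) \<noteq> {}"
  shows "f ` A \<inter> f ` B \<noteq> {}"
proof -
  obtain M d where M: "Metric_space M d" "Metric_space.mcomplete M d" and Peq: "P = Metric_space.mtopology M d"
    using P unfolding completely_metrizable_space_def by blast
  interpret Metric_space M d by fact
  define I where "I A = Y interior_of (Y closure_of (f ` A))" for A
  define linked where "linked A B \<longleftrightarrow> openin P A \<and> openin P B \<and> f ` B \<inter> I A \<noteq> {}" for A B
  define refines where "refines n A' A \<longleftrightarrow>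
    mtopology closure_of A' \<subseteq> A \<and> (\<exists>c. A' \<subseteq> mcball c (inverse (Suc n)))" for n A' A
  have step: "\<exists>B'. linked B' A \<and> refines n B' B" if link: "linked A B" for A B n
  proof -
    obtain k where k: "k \<in> B" "f k \<in> I A" and op: "openin mtopology A" "openin mtopology B"
      using link unfolding linked_def Peq by blast
    obtain s where s: "s > 0" "s \<le> inverse (Suc n)" "mcball k s \<subseteq> B"
      using openin_small_ball[OF op(2) k(1), of "inverse (Suc n)"] by auto
    define B' where "B' = mball k s"
    have "k \<in> M"
      using openin_subset[OF op(2)] k(1) by auto
    then have kB': "k \<in> B'"
      using s(1) by (simp add: B'_def)
    have B': "openin P B'"
      by (simp add: B'_def Peq)
    have "f k \<in> I B'"
      using almost[OF B'] kB' unfolding I_def by blast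
    moreover have "f k \<in> Y closure_of (f ` A)"
      using k(2) interior_of_subset unfolding I_def by fast
    moreover have "openin Y (I B')"
      by (simp add: I_def)
    ultimately have "f ` A \<inter> I B' \<noteq> {}"
      unfolding in_closure_of by blast
    then have "linked B' A"
      using link B' by (simp add: linked_def)
    moreover have "mtopology closure_of B' \<subseteq> mcball k s"
      unfolding B'_def by (simp add: closure_of_minimal mball_subset_mcball)
    moreover have "B' \<subseteq> mcball k (inverse (Suc n))"
      unfolding B'_def using mball_subset_mcball mcball_subset_concentric[OF s(2)] by (rule subset_trans)
    ultimately show ?thesis
      using s(3) unfolding refines_def by (meson subset_trans)
  qed
  \<comment> \<open>Two exchanges restore the order of the pair, with both sets shrunk.\<close>
  have step2: "\<exists>A' B'. linked A' B' \<and> refines n A' A \<and> refines n B' B" if "linked A B" for A B n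
    using step that by meson
  have "linked A B"
    using A B meet by (simp add: linked_def I_def)
  define small where "small n A' \<longleftrightarrow> (\<exists>c. A' \<subseteq> mcball c (inverse (Suc n)))" for n and A' :: "'a set"
  have refines_small: "small n A'" if "refines n A' A" for n A' A
    using that by (simp add: refines_def small_def)
  have sub: "A' \<subseteq> A" if "refines n A' A" "openin P A'" for A' A n
    using that closure_of_subset[of A' mtopology] openin_subset[of P A'] by (auto simp: refines_def Peq)
  \<comment> \<open>The chain starts one double exchange below \<open>(A, B)\<close>, since
    \<open>A\<close> and \<open>B\<close> themselves need not be small.\<close>
  have "\<exists>S. \<forall>n. (linked (fst (S n)) (snd (S n)) \<and> small n (fst (S n)) \<and> small n (snd (S n))
              \<and> fst (S n) \<subseteq> A \<and> snd (S n) \<subseteq> B)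
      \<and> (refines (Suc n) (fst (S (Suc n))) (fst (S n)) \<and> refines (Suc n) (snd (S (Suc n))) (snd (S n)))"
  proof (rule dependent_nat_choice)
    obtain A' B' where "linked A' B'" "refines 0 A' A" "refines 0 B' B"
      using step2[OF \<open>linked A B\<close>] by blast
    then show "\<exists>S. linked (fst S) (snd S) \<and> small 0 (fst S) \<and> small 0 (snd S) \<and> fst S \<subseteq> A \<and> snd S \<subseteq> B"
      using refines_small sub by (intro exI[of _ "(A', B')"]) (auto simp: linked_def)
  next
    fix S n
    assume *: "linked (fst S) (snd S) \<and> small n (fst S) \<and> small n (snd S) \<and> fst S \<subseteq> A \<and> snd S \<subseteq> B"
    then obtain A' B' where AB: "linked A' B'" "refines (Suc n) A' (fst S)" "refines (Suc n) B' (snd S)"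
      using step2 by blast
    then have "A' \<subseteq> fst S" "B' \<subseteq> snd S"
      using sub by (auto simp: linked_def)
    with AB * show "\<exists>S'. (linked (fst S') (snd S') \<and> small (Suc n) (fst S') \<and> small (Suc n) (snd S')
          \<and> fst S' \<subseteq> A \<and> snd S' \<subseteq> B)
        \<and> (refines (Suc n) (fst S') (fst S) \<and> refines (Suc n) (snd S') (snd S))"
      using refines_small by (intro exI[of _ "(A', B')"]) auto
  qed
  then obtain S where S: "\<And>n. linked (fst (S n)) (snd (S n))"
    "\<And>n. small n (fst (S n))" "\<And>n. small n (snd (S n))"
    "\<And>n. fst (S n) \<subseteq> A" "\<And>n. snd (S n) \<subseteq> B"
    "\<And>n. refines (Suc n) (fst (S (Suc n))) (fst (S n))"
    "\<And>n. refines (Suc n) (snd (S (Suc n))) (snd (S n))"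
    by blast
  have ops: "openin P (fst (S n))" "openin P (snd (S n))" and hit: "f ` snd (S n) \<inter> I (fst (S n)) \<noteq> {}" for n
    using S(1) by (auto simp: linked_def)
  \<comment> \<open>A link forces both sets to be nonempty: the closure of an empty image has empty
    interior.\<close>
  have "f ` fst (S n) \<noteq> {}" for n
  proof
    assume "f ` fst (S n) = {}"
    then have "I (fst (S n)) = {}"
      by (simp add: I_def interior_of_eq_empty_alt)
    then show False
      using hit by blast
  qed
  then have ne: "fst (S n) \<noteq> {}" "snd (S n) \<noteq> {}" for n
    using hit by blast+
  have in_M: "U \<subseteq> M" if "openin P U" for U
    using openin_subset[OF that] by (simp add: Peq)
  obtain p where p: "\<And>n. p \<in> fst (S n)"
    "\<And>V. openin mtopology V \<Longrightarrow> p \<in> V \<Longrightarrow> \<exists>n. fst (S n) \<subseteq> V"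
  proof (rule complete_nest_point[OF M(2), of "\<lambda>n. fst (S n)"])
    show "mtopology closure_of (fst (S (Suc n))) \<subseteq> fst (S n)" for n
      using S(6)[of n] by (simp add: refines_def)
    show "\<exists>c. fst (S n) \<subseteq> mcball c (inverse (Suc n))" for n
      using S(2)[of n] by (simp only: small_def)
  qed (use ne ops in_M in auto)
  obtain q where q: "\<And>n. q \<in> snd (S n)"
    "\<And>V. openin mtopology V \<Longrightarrow> q \<in> V \<Longrightarrow> \<exists>n. snd (S n) \<subseteq> V"
  proof (rule complete_nest_point[OF M(2), of "\<lambda>n. snd (S n)"])
    show "mtopology closure_of (snd (S (Suc n))) \<subseteq> snd (S n)" for n
      using S(7)[of n] by (simp add: refines_def)
    show "\<exists>c. snd (S n) \<subseteq> mcball c (inverse (Suc n))" for n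
      using S(3)[of n] by (simp only: small_def)
  qed (use ne ops in_M in auto)
  have pq: "p \<in> M" "q \<in> M"
    using p(1) q(1) in_M ops by blast+
  have "f p = f q"
  proof (rule ccontr)
    assume "f p \<noteq> f q"
    moreover have "f p \<in> topspace Y" "f q \<in> topspace Y"
      using pq f by (auto simp: continuous_map_def Peq)
    ultimately obtain O1 O2 where O: "openin Y O1" "openin Y O2" "f p \<in> O1" "f q \<in> O2" "disjnt O1 O2"
      using Y unfolding Hausdorff_space_def by blast
    have pre: "openin mtopology {z \<in> M. f z \<in> Q}" if "openin Y Q" for Q
      using f that by (simp add: continuous_map_def Peq)
    obtain n1 where n1: "fst (S n1) \<subseteq> {z \<in> M. f z \<in> O1}"
      using p(2)[OF pre[OF O(1)]] pq(1) O(3) by auto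
    obtain n2 where n2: "snd (S n2) \<subseteq> {z \<in> M. f z \<in> O2}"
      using q(2)[OF pre[OF O(2)]] pq(2) O(4) by auto
    \<comment> \<open>Both inclusions are wanted at one index, hence the maximum. There the link
      yields a point of \<open>O2\<close> in the closure of a set inside \<open>O1\<close>, against
      disjointness.\<close>
    have "decseq (\<lambda>n. fst (S n))" "decseq (\<lambda>n. snd (S n))"
      using sub[OF S(6) ops(1)] sub[OF S(7) ops(2)] by (auto intro!: decseq_SucI simp del: split_paired_All)
    then have "fst (S (max n1 n2)) \<subseteq> fst (S n1)" "snd (S (max n1 n2)) \<subseteq> snd (S n2)"
      by (simp_all add: decseq_def)
    with n1 n2 have AB: "f ` fst (S (max n1 n2)) \<subseteq> O1" "f ` snd (S (max n1 n2)) \<subseteq> O2"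
      by auto
    obtain k where "k \<in> snd (S (max n1 n2))" "f k \<in> I (fst (S (max n1 n2)))"
      using hit by blast
    then have "f k \<in> O2" "f k \<in> Y closure_of (f ` fst (S (max n1 n2)))"
      using AB(2) interior_of_subset[of Y] unfolding I_def by blast+
    then have "O2 \<inter> f ` fst (S (max n1 n2)) \<noteq> {}"
      using O(2) unfolding in_closure_of by blast
    then show False
      using AB(1) O(5) by (auto simp: disjnt_def)
  qed
  moreover have "p \<in> A" "q \<in> B"
    using p(1) q(1) S(4,5) by blast+
  ultimately show ?thesis
    by blast
qed

section \<open>Partial actions and translations\<close>

context partial_action
begin

lemma m_Some_iff_pa_act: "m g x = Some y \<longleftrightarrow> g \<in> pa_at m x \<and> pa_act m g x = y"
  by (auto simp: pa_at_def pa_act_def)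

lemma pa_at_carrier: "pa_at m x \<subseteq> carrier G"
  using defined_only by (auto simp: pa_at_def)

lemma pa_orbit_eq: "pa_orbit m x = {y. \<exists>g. m g x = Some y}"
  by (auto simp: pa_orbit_def m_Some_iff_pa_act)

lemma pa_orbit_subset: "pa_orbit m x \<subseteq> X"
  using defined_only by (auto simp: pa_orbit_eq)

lemma pa_orbit_closed: "y \<in> pa_orbit m x \<Longrightarrow> m g y = Some z \<Longrightarrow> z \<in> pa_orbit m x"
  using PA2 by (fastforce simp: pa_orbit_eq)

text \<open>\<open>inv g\<close> leads from \<open>y\<close> back to \<open>x\<close>, and
  \<open>h\<close> on to \<open>z\<close>; any two points of an orbit are joined in this
  way.\<close>

lemma act_divide:
  assumes "m g x = Some y" "m h x = Some z"
  shows "m (h \<otimes> inv g) y = Some z"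
  using PA2[OF PA1[OF assms(1)] assms(2)] .

text \<open>If \<open>h\<close> and \<open>g\<close> send \<open>x\<close> to the same point, then
  for \<open>k\<close> in the coset of \<open>h\<close> the element \<open>inv g \<otimes> k\<close>
  fixes \<open>x\<close>, so \<open>k\<close> lies in the coset of \<open>g\<close>; by symmetry the
  cosets agree.\<close>

lemma inj_on_pa_orbit_map:
  "inj_on (pa_orbit_map G m x) ((\<lambda>g. g <# pa_stabilizer m x) ` pa_at m x)"
proof -
  have sub: "h <# pa_stabilizer m x \<subseteq> g <# pa_stabilizer m x"
    if "m g x = Some y" "m h x = Some y" for g h y
  proof
    have car: "g \<in> carrier G" "h \<in> carrier G"
      using that defined_only by blast+
    fix k assume "k \<in> h <# pa_stabilizer m x"
    then obtain s where s: "m s x = Some x" "k = h \<otimes> s"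
      by (auto simp: l_coset_def pa_stabilizer_def m_Some_iff_pa_act)
    have "m (inv g \<otimes> (h \<otimes> s)) x = Some x"
      using PA2[OF PA2[OF s(1) that(2)] PA1[OF that(1)]] .
    moreover have "k = g \<otimes> (inv g \<otimes> (h \<otimes> s))"
      using car s defined_only[OF s(1)] by (simp add: m_assoc[symmetric])
    ultimately show "k \<in> g <# pa_stabilizer m x"
      unfolding l_coset_def by (auto simp: pa_stabilizer_def m_Some_iff_pa_act)
  qed
  show ?thesis
  proof (rule inj_onI, elim imageE, simp add: pa_orbit_map_coset)
    fix g h assume "g \<in> pa_at m x" "h \<in> pa_at m x" "pa_act m g x = pa_act m h x"
    then show "g <# pa_stabilizer m x = h <# pa_stabilizer m x"
      using sub[of g _ h] sub[of h _ g] by (auto simp: m_Some_iff_pa_act)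
  qed
qed

text \<open>The preimage of \<open>S\<close> under the partial bijection \<open>m h\<close>; for
  \<open>h\<close> in the group it is also the image under \<open>inv h\<close> of the part of
  \<open>S\<close> on which \<open>inv h\<close> acts.\<close>

definition act_vimage :: "'a \<Rightarrow> 'x set \<Rightarrow> 'x set" where
  "act_vimage h S = {z. \<exists>w\<in>S. m h z = Some w}"

text \<open>Only an inclusion, since points of \<open>S\<close> on which \<open>inv h\<close> does
  not act drop out.\<close>

lemma act_vimage_inv:
  "h \<in> carrier G \<Longrightarrow> z \<in> act_vimage (inv h) (act_vimage h S) \<Longrightarrow> z \<in> S"
  using PA1 by (fastforce simp: act_vimage_def)

end

section \<open>Translations and neighbourhoods in a topological group\<close>

context topological_group_on
begin

lemma continuous_right_translation:
  assumes "h \<in> carrier G"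
  shows "continuous_map T T (\<lambda>g. g \<otimes> h)"
proof -
  have "continuous_map T (prod_topology T T) (\<lambda>g. (g, h))"
    using assms topspace_eq by (simp add: continuous_map_pairedI)
  from continuous_map_compose[OF this continuous_mult] show ?thesis
    by (simp add: o_def)
qed

lemma continuous_left_translation:
  assumes "h \<in> carrier G"
  shows "continuous_map T T (\<lambda>g. h \<otimes> g)"
proof -
  have "continuous_map T (prod_topology T T) (\<lambda>g. (h, g))"
    using assms topspace_eq by (simp add: continuous_map_pairedI)
  from continuous_map_compose[OF this continuous_mult] show ?thesis
    by (simp add: o_def)
qed

lemma openin_right_translate:
  assumes "openin T U" "h \<in> carrier G"
  shows "openin T ((\<lambda>g. g \<otimes> h) ` U)"
proof -
  have "(\<lambda>g. g \<otimes> h) ` U = {g \<in> topspace T. g \<otimes> inv h \<in> U}"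
  proof (intro subset_antisym subsetI)
    fix g assume "g \<in> (\<lambda>g. g \<otimes> h) ` U"
    then show "g \<in> {g \<in> topspace T. g \<otimes> inv h \<in> U}"
      using assms openin_subset[OF assms(1)] by (auto simp: topspace_eq m_assoc)
  next
    fix g assume g: "g \<in> {g \<in> topspace T. g \<otimes> inv h \<in> U}"
    then have "g = (g \<otimes> inv h) \<otimes> h"
      using assms by (simp add: topspace_eq m_assoc)
    with g show "g \<in> (\<lambda>g. g \<otimes> h) ` U"
      by blast
  qed
  then show ?thesis
    using openin_continuous_map_preimage[OF continuous_right_translation assms(1)] assms(2) by simp
qed

lemma obtain_factor_nbhds:
  assumes "openin T U" "g \<otimes> h \<in> U" "g \<in> carrier G" "h \<in> carrier G"
  obtains V W where "openin T V" "openin T W" "g \<in> V" "h \<in> W"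
    "\<And>v w. v \<in> V \<Longrightarrow> w \<in> W \<Longrightarrow> v \<otimes> w \<in> U"
proof -
  have "openin (prod_topology T T) {p \<in> topspace (prod_topology T T). (\<lambda>(g, h). g \<otimes> h) p \<in> U}"
    using openin_continuous_map_preimage[OF continuous_mult assms(1)] .
  moreover have "(g, h) \<in> {p \<in> topspace (prod_topology T T). (\<lambda>(g, h). g \<otimes> h) p \<in> U}"
    using assms by (simp add: topspace_eq)
  ultimately obtain V W where VW: "openin T V" "openin T W" "g \<in> V" "h \<in> W"
    "V \<times> W \<subseteq> {p \<in> topspace (prod_topology T T). (\<lambda>(g, h). g \<otimes> h) p \<in> U}"
    unfolding openin_prod_topology_alt by meson
  show thesis
  proof
    show "v \<otimes> w \<in> U" if "v \<in> V" "w \<in> W" for v w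
      using subsetD[OF VW(5), of "(v, w)"] that by simp
  qed (rule VW)+
qed

text \<open>Continuity of \<open>g \<otimes> inv v \<otimes> w\<close> at
  \<open>v = w = \<one>\<close>. In its use \<open>v\<close> is a fixed point of \<open>W\<close>,
  so that translating \<open>W\<close> by \<open>g \<otimes> inv v\<close> stays inside
  \<open>U\<close>.\<close>

lemma obtain_quotient_nbhd:
  assumes "openin T U" "g \<in> U"
  obtains W where "openin T W" "\<one> \<in> W" "\<And>v w. v \<in> W \<Longrightarrow> w \<in> W \<Longrightarrow> g \<otimes> inv v \<otimes> w \<in> U"
proof -
  have g: "g \<in> carrier G"
    using assms openin_subset[OF assms(1)] topspace_eq by blast
  obtain V W where VW: "openin T V" "openin T W" "g \<in> V" "\<one> \<in> W"
    "\<And>v w. v \<in> V \<Longrightarrow> w \<in> W \<Longrightarrow> v \<otimes> w \<in> U"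
    using obtain_factor_nbhds[OF assms(1), of g \<one>] g assms(2) by (metis one_closed r_one)
  have "continuous_map T T (\<lambda>v. g \<otimes> inv v)"
    using continuous_map_compose[OF continuous_inv continuous_left_translation[OF g]] by (simp add: o_def)
  then have "openin T {v \<in> topspace T. g \<otimes> inv v \<in> V}"
    using VW(1) by (rule openin_continuous_map_preimage)
  then show thesis
    using VW g by (intro that[of "{v \<in> topspace T. g \<otimes> inv v \<in> V} \<inter> W"]) (auto simp: topspace_eq)
qed

end

section \<open>The orbit map\<close>

lemma closure_of_meets:
  "x \<in> X closure_of S \<Longrightarrow> openin X U \<Longrightarrow> x \<in> U \<Longrightarrow> \<exists>y\<in>S. y \<in> U"
  by (auto simp: in_closure_of)

section \<open>Open and nowhere dense sets under the partial action\<close>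

context continuous_partial_action
begin

lemma openin_act_vimage:
  assumes h: "h \<in> carrier G" and S: "openin TX S"
  shows "openin TX (act_vimage h S)"
proof -
  have src: "openin TX (pa_source m h)"
    using open_source[of "inv h"] h by simp
  have "continuous_map (subtopology TX (pa_source m h)) TX (pa_act m h)"
    using homeomorphic_imp_continuous_map[OF homeomorphic_act[OF h]]
    by (simp add: continuous_map_in_subtopology)
  then have "openin (subtopology TX (pa_source m h))
      {z \<in> topspace (subtopology TX (pa_source m h)). pa_act m h z \<in> S}"
    using S by (rule openin_continuous_map_preimage)
  moreover have "{z \<in> topspace (subtopology TX (pa_source m h)). pa_act m h z \<in> S} = act_vimage h S"
    using defined_only by (fastforce simp: act_vimage_def pa_source_def pa_act_def)
  ultimately show ?thesis
    using src openin_trans_full by metis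
qed

lemma continuous_orbit_map:
  "continuous_map (subtopology TG (pa_at m x)) TX (\<lambda>g. pa_act m g x)"
proof (cases "x \<in> topspace TX")
  case True
  have "continuous_map (subtopology TG (pa_at m x)) (prod_topology TG TX) (\<lambda>g. (g, x))"
    using True by (simp add: continuous_map_pairedI continuous_map_from_subtopology)
  moreover have "(\<lambda>g. (g, x)) \<in> topspace (subtopology TG (pa_at m x)) \<rightarrow> pa_dom m"
    by (auto simp: pa_at_def pa_dom_def)
  ultimately have "continuous_map (subtopology TG (pa_at m x))
      (subtopology (prod_topology TG TX) (pa_dom m)) (\<lambda>g. (g, x))"
    by (simp add: continuous_map_in_subtopology image_subset_iff_funcset)
  from continuous_map_compose[OF this continuous_act] show ?thesis
    by (simp add: o_def)
next
  case False
  then have "m g x = None" for g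
    using defined_only by (cases "m g x") auto
  then have "pa_at m x = {}"
    by (simp add: pa_at_def)
  then show ?thesis
    by simp
qed

abbreviation orbit_topology :: "'x \<Rightarrow> 'x topology" where
  "orbit_topology x \<equiv> subtopology TX (pa_orbit m x)"

lemma topspace_Int_pa_orbit [simp]: "topspace TX \<inter> pa_orbit m x = pa_orbit m x"
  using pa_orbit_subset by blast

lemma topspace_Int_pa_at [simp]: "topspace TG \<inter> pa_at m x = pa_at m x"
  using pa_at_carrier topspace_eq by blast

lemma continuous_map_into_orbit:
  "continuous_map (subtopology TG (pa_at m x)) (orbit_topology x) (\<lambda>g. pa_act m g x)"
  using continuous_orbit_map by (auto simp: continuous_map_in_subtopology pa_orbit_def)

text \<open>The action and its inverses preserve the orbit, so taking preimages commutes with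
  intersecting with it.\<close>

lemma openin_orbit_act_vimage:
  assumes "h \<in> carrier G" "openin (orbit_topology x) S"
  shows "openin (orbit_topology x) (act_vimage h S)"
proof -
  obtain S' where S': "openin TX S'" "S = S' \<inter> pa_orbit m x"
    using assms(2) by (auto simp: openin_subtopology)
  have "act_vimage h S = act_vimage h S' \<inter> pa_orbit m x"
    using PA1 pa_orbit_closed unfolding S'(2) act_vimage_def by blast
  then show ?thesis
    using openin_act_vimage[OF assms(1) S'(1)] by (auto simp: openin_subtopology)
qed

text \<open>A neighbourhood \<open>N\<close> of \<open>z\<close> is moved to the neighbourhood
  \<open>act_vimage (inv h) N\<close> of \<open>w\<close>, which meets \<open>S\<close>;
  \<open>inv h\<close> takes a common point back to a point of \<open>N\<close> that
  \<open>h\<close> sends into \<open>S\<close>.\<close>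

lemma orbit_act_vimage_closure_of:
  assumes h: "h \<in> carrier G"
  shows "act_vimage h (orbit_topology x closure_of S) \<subseteq> orbit_topology x closure_of act_vimage h S"
proof
  fix z assume "z \<in> act_vimage h (orbit_topology x closure_of S)"
  then obtain w where w: "w \<in> orbit_topology x closure_of S" "m h z = Some w"
    by (auto simp: act_vimage_def)
  have wz: "m (inv h) w = Some z"
    using PA1 w(2) .
  have "\<exists>y\<in>act_vimage h S. y \<in> N" if N: "openin (orbit_topology x) N" "z \<in> N" for N
  proof -
    have "w \<in> act_vimage (inv h) N"
      using wz N(2) by (auto simp: act_vimage_def)
    then obtain s where s: "s \<in> S" "s \<in> act_vimage (inv h) N"
      using w(1) openin_orbit_act_vimage[of "inv h", OF _ N(1)] h unfolding in_closure_of by auto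
    then obtain n where n: "n \<in> N" "m (inv h) s = Some n"
      by (auto simp: act_vimage_def)
    then have "m h n = Some s"
      using PA1[OF n(2)] h by simp
    then show ?thesis
      using n(1) s(1) by (auto simp: act_vimage_def)
  qed
  moreover have "z \<in> topspace (orbit_topology x)"
    using w(1) wz pa_orbit_closed by (auto simp: in_closure_of)
  ultimately show "z \<in> orbit_topology x closure_of act_vimage h S"
    by (auto simp: in_closure_of)
qed

lemma act_vimage_mono: "S \<subseteq> S' \<Longrightarrow> act_vimage h S \<subseteq> act_vimage h S'"
  by (auto simp: act_vimage_def)

text \<open>An open set \<open>Q\<close> inside the closure of the preimage is pulled back by
  \<open>inv h\<close> into the interior of the closure of \<open>S\<close>, which is empty.\<close>

lemma nowhere_dense_act_vimage:
  assumes h: "h \<in> carrier G" and S: "nowhere_dense_in (orbit_topology x) S"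
  shows "nowhere_dense_in (orbit_topology x) (act_vimage h S)"
proof -
  let ?Y = "orbit_topology x"
  have sub: "S \<subseteq> pa_orbit m x"
    using S by (simp add: nowhere_dense_in_def)
  have vsub: "act_vimage h S \<subseteq> pa_orbit m x"
    using PA1 pa_orbit_closed sub unfolding act_vimage_def by blast
  define Q where "Q = ?Y interior_of (?Y closure_of act_vimage h S)"
  have Q: "openin ?Y Q" "Q \<subseteq> ?Y closure_of act_vimage h S"
    by (simp_all add: Q_def interior_of_subset)
  have "act_vimage (inv h) Q \<subseteq> ?Y closure_of (act_vimage (inv h) (act_vimage h S))"
    using act_vimage_mono[OF Q(2)] orbit_act_vimage_closure_of[of "inv h"] h by blast
  also have "\<dots> \<subseteq> ?Y closure_of S"
    using act_vimage_inv[OF h] by (intro closure_of_mono) blast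
  finally have "act_vimage (inv h) Q \<subseteq> ?Y interior_of (?Y closure_of S)"
    using openin_orbit_act_vimage[of "inv h", OF _ Q(1)] h by (simp add: interior_of_maximal)
  then have empty: "act_vimage (inv h) Q = {}"
    using S by (simp add: nowhere_dense_in_def)
  \<comment> \<open>The pullback of \<open>Q\<close> might be empty merely because \<open>h\<close>
    is undefined on \<open>Q\<close>. This is excluded: a nonempty \<open>Q\<close> meets
    \<open>act_vimage h S\<close>, where \<open>h\<close> is defined.\<close>
  have "Q = {}"
  proof (rule ccontr)
    assume "Q \<noteq> {}"
    then obtain z where "z \<in> Q" "z \<in> act_vimage h S"
      using closure_of_meets[OF _ Q(1)] Q(2) by blast
    then show False
      using empty PA1 by (fastforce simp: act_vimage_def)
  qed
  then show ?thesis
    using vsub by (simp add: nowhere_dense_in_def Q_def)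
qed

section \<open>Openness of the orbit map\<close>

lemma orbit_map_almost_open:
  assumes sep: "separable_space TG" and opn: "openin TG (pa_at m x)" and x: "x \<in> topspace TX"
    and nonmeager: "\<not> meager_in (orbit_topology x) (pa_orbit m x)"
    and U: "openin TG U" "U \<subseteq> pa_at m x"
  shows "(\<lambda>g. pa_act m g x) ` U \<subseteq>
    orbit_topology x interior_of (orbit_topology x closure_of ((\<lambda>g. pa_act m g x) ` U))"
proof
  let ?Y = "orbit_topology x" and ?f = "\<lambda>g. pa_act m g x"
  have m_f: "m g x = Some (?f g)" if "g \<in> pa_at m x" for g
    using that by (simp add: m_Some_iff_pa_act)
  fix y assume "y \<in> ?f ` U"
  then obtain g where g: "g \<in> U" "y = ?f g"
    by blast
  have gc: "g \<in> carrier G"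
    using g(1) U(2) pa_at_carrier by blast
  have one: "\<one> \<in> pa_at m x"
    using PA3[OF x] by (simp add: pa_at_def)
  obtain W0 where W0: "openin TG W0" "\<one> \<in> W0" "\<And>v w. v \<in> W0 \<Longrightarrow> w \<in> W0 \<Longrightarrow> g \<otimes> inv v \<otimes> w \<in> U"
    using obtain_quotient_nbhd[OF U(1) g(1)] by blast
  \<comment> \<open>Elements of \<open>W\<close> must act on \<open>x\<close>; openness of
    \<open>pa_at m x\<close> keeps the intersection open.\<close>
  define W where "W = W0 \<inter> pa_at m x"
  have W: "openin TG W" "\<one> \<in> W" "W \<subseteq> pa_at m x" "\<And>v w. v \<in> W \<Longrightarrow> w \<in> W \<Longrightarrow> g \<otimes> inv v \<otimes> w \<in> U"
    using W0 opn one by (auto simp: W_def)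
  have Wc: "W \<subseteq> carrier G"
    using W(3) pa_at_carrier by blast
  obtain D where D: "countable D" "D \<subseteq> carrier G" "TG closure_of D = carrier G"
    using sep by (auto simp: separable_space_def topspace_eq)
  have "\<not> nowhere_dense_in ?Y (?f ` W)"
  proof
    assume nd: "nowhere_dense_in ?Y (?f ` W)"
    \<comment> \<open>If \<open>k\<close> sends \<open>x\<close> to \<open>z\<close>, density gives
      \<open>d\<close> in \<open>D\<close> so close to \<open>k\<close> that
      \<open>inv d \<otimes> k\<close> lies in \<open>W\<close>. Then \<open>inv d\<close> acts on
      \<open>z\<close>, with value in the image of \<open>W\<close>.\<close>
    have "\<exists>d\<in>D. z \<in> act_vimage (inv d) (?f ` W)" if z: "z \<in> pa_orbit m x" for z
    proof -
      obtain k where k: "m k x = Some z"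
        using z by (auto simp: pa_orbit_eq)
      then have kc: "k \<in> carrier G"
        using defined_only by blast
      have "continuous_map TG TG (\<lambda>d. inv d \<otimes> k)"
        using continuous_map_compose[OF continuous_inv continuous_right_translation[OF kc]]
        by (simp add: o_def)
      then have N: "openin TG {d \<in> topspace TG. inv d \<otimes> k \<in> W}"
        using W(1) by (rule openin_continuous_map_preimage)
      moreover have "k \<in> {d \<in> topspace TG. inv d \<otimes> k \<in> W}"
        using kc W(2) by (simp add: topspace_eq)
      moreover have "k \<in> TG closure_of D"
        using kc D(3) by simp
      ultimately obtain d where d: "d \<in> D" "inv d \<otimes> k \<in> W"
        using closure_of_meets[OF _ N, of k D] by auto
      have dc: "d \<in> carrier G"
        using d(1) D(2) by blast
      have "m (inv d \<otimes> k \<otimes> inv k) z = Some (?f (inv d \<otimes> k))"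
        using act_divide[OF k m_f] d(2) W(3) by blast
      then have "m (inv d) z = Some (?f (inv d \<otimes> k))"
        using dc kc by (simp add: m_assoc)
      then show ?thesis
        using d by (auto simp: act_vimage_def)
    qed
    moreover have "act_vimage (inv d) (?f ` W) \<subseteq> pa_orbit m x" if "d \<in> D" for d
      using nowhere_dense_act_vimage[OF _ nd, of "inv d"] that D(2) by (auto simp: nowhere_dense_in_def)
    ultimately have "pa_orbit m x = \<Union>((\<lambda>d. act_vimage (inv d) (?f ` W)) ` D)"
      by blast
    moreover have "\<forall>N\<in>(\<lambda>d. act_vimage (inv d) (?f ` W)) ` D. nowhere_dense_in ?Y N"
      using nowhere_dense_act_vimage[OF _ nd] D(2) by auto
    ultimately have "meager_in ?Y (pa_orbit m x)"
      unfolding meager_in_def using D(1) by (metis countable_image)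
    then show False
      using nonmeager by simp
  qed
  moreover have "?f ` W \<subseteq> topspace ?Y"
    unfolding topspace_subtopology topspace_Int_pa_orbit using W(3) by (auto simp: pa_orbit_def)
  ultimately have "?Y interior_of (?Y closure_of ?f ` W) \<noteq> {}" (is "?Q \<noteq> _")
    by (simp add: nowhere_dense_in_def)
  then obtain w where w: "w \<in> W" "?f w \<in> ?Q"
    using closure_of_meets[OF _ openin_interior_of[of ?Y]] interior_of_subset[of ?Y "?Y closure_of ?f ` W"]
    by blast
  \<comment> \<open>\<open>h\<close> moves \<open>y\<close> to \<open>?f w\<close>, a point of
    \<open>?Q\<close>, so the preimage of \<open>?Q\<close> under \<open>h\<close> is a
    neighbourhood of \<open>y\<close>. As \<open>inv h = g \<otimes> inv w\<close>, the choice of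
    \<open>W\<close> puts the preimage of the image of \<open>W\<close> into the image of
    \<open>U\<close>.\<close>
  define h where "h = w \<otimes> inv g"
  have wc: "w \<in> carrier G" and hc: "h \<in> carrier G"
    using w(1) Wc gc by (auto simp: h_def)
  have "m h y = Some (?f w)"
    unfolding h_def g(2) using act_divide m_f g(1) U(2) w(1) W(3) by blast
  then have "y \<in> act_vimage h ?Q"
    using w(2) by (auto simp: act_vimage_def)
  moreover have "openin ?Y (act_vimage h ?Q)"
    using hc by (simp add: openin_orbit_act_vimage)
  moreover have "act_vimage h ?Q \<subseteq> ?Y closure_of (?f ` U)"
  proof -
    have "act_vimage h ?Q \<subseteq> act_vimage h (?Y closure_of ?f ` W)"
      by (intro act_vimage_mono interior_of_subset)
    also have "\<dots> \<subseteq> ?Y closure_of act_vimage h (?f ` W)"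
      using hc by (rule orbit_act_vimage_closure_of)
    also have "\<dots> \<subseteq> ?Y closure_of (?f ` U)"
    proof (intro closure_of_mono subsetI)
      fix z assume "z \<in> act_vimage h (?f ` W)"
      then obtain v where v: "v \<in> W" "m h z = Some (?f v)"
        by (auto simp: act_vimage_def)
      have vc: "v \<in> carrier G"
        using v(1) Wc by blast
      have "m (inv h \<otimes> v) x = Some z"
        using PA2[OF m_f PA1[OF v(2)]] v(1) W(3) by blast
      moreover have "inv h \<otimes> v = g \<otimes> inv w \<otimes> v"
        using gc wc by (simp add: h_def inv_mult_group)
      ultimately show "z \<in> ?f ` U"
        using W(4)[OF w(1) v(1)] by (force simp: pa_act_def)
    qed
    finally show ?thesis .
  qed
  ultimately show "y \<in> ?Y interior_of (?Y closure_of (?f ` U))"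
    unfolding interior_of_def by blast
qed

text \<open>The interior of the closure of the image of a smaller set \<open>V\<close> already lies
  in the image of \<open>U\<close>: the factor \<open>W\<close>, with products of \<open>W\<close>
  and \<open>V\<close> in \<open>U\<close>, absorbs the error of approximation.\<close>

lemma open_orbit_map:
  assumes sep: "separable_space TG" and compl: "completely_metrizable_space TG"
    and Haus: "Hausdorff_space TX"
    and opn: "openin TG (pa_at m x)" and x: "x \<in> topspace TX"
    and nonmeager: "\<not> meager_in (orbit_topology x) (pa_orbit m x)"
  shows "open_map (subtopology TG (pa_at m x)) (orbit_topology x) (\<lambda>g. pa_act m g x)"
  unfolding open_map_def
proof (intro allI impI)
  let ?Y = "orbit_topology x" and ?f = "\<lambda>g. pa_act m g x" and ?P = "subtopology TG (pa_at m x)"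
  have m_f: "m g x = Some (?f g)" if "g \<in> pa_at m x" for g
    using that by (simp add: m_Some_iff_pa_act)
  have open_P: "openin ?P V \<longleftrightarrow> openin TG V \<and> V \<subseteq> pa_at m x" for V
    using opn by (rule openin_open_subtopology)
  have almost: "?f ` V \<subseteq> ?Y interior_of (?Y closure_of (?f ` V))" if "openin ?P V" for V
    using orbit_map_almost_open[OF sep opn x nonmeager] that open_P by simp
  fix U assume "openin ?P U"
  then have U: "openin TG U" "U \<subseteq> pa_at m x"
    using open_P by auto
  have "\<exists>Q. openin ?Y Q \<and> y \<in> Q \<and> Q \<subseteq> ?f ` U" if y: "y \<in> ?f ` U" for y
  proof -
    obtain g where g: "g \<in> U" "y = ?f g"
      using y by blast
    have gc: "g \<in> carrier G"
      using g(1) U(2) pa_at_carrier by blast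
    obtain W V0 where VW: "openin TG W" "openin TG V0" "\<one> \<in> W" "g \<in> V0"
      "\<And>w v. w \<in> W \<Longrightarrow> v \<in> V0 \<Longrightarrow> w \<otimes> v \<in> U"
      using obtain_factor_nbhds[OF U(1), of \<one> g] g(1) gc by auto
    define V where "V = V0 \<inter> pa_at m x"
    have V: "openin ?P V" "g \<in> V"
      using VW(2,4) opn g(1) U(2) by (auto simp: V_def open_P)
    let ?Q = "?Y interior_of (?Y closure_of (?f ` V))"
    have "y \<in> ?Q"
      using almost[OF V(1)] V(2) g(2) by blast
    moreover have "?Q \<subseteq> ?f ` U"
    proof
      fix z assume z: "z \<in> ?Q"
      then have "z \<in> pa_orbit m x"
        using interior_of_subset_topspace[of ?Y] by auto
      then obtain k where k: "k \<in> pa_at m x" "z = ?f k"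
        by (auto simp: pa_orbit_def)
      have kc: "k \<in> carrier G"
        using k(1) pa_at_carrier by blast
      have "continuous_map TG TG (\<lambda>b. k \<otimes> inv b)"
        using continuous_map_compose[OF continuous_inv continuous_left_translation[OF kc]]
        by (simp add: o_def)
      then have "openin TG {b \<in> topspace TG. k \<otimes> inv b \<in> W}"
        using VW(1) by (rule openin_continuous_map_preimage)
      \<comment> \<open>\<open>?B\<close> consists of the \<open>b\<close> so close to
        \<open>k\<close> that the correction \<open>k \<otimes> inv b\<close> lies in
        \<open>W\<close>.\<close>
      then have B: "openin ?P ({b \<in> topspace TG. k \<otimes> inv b \<in> W} \<inter> pa_at m x)" (is "openin _ ?B")
        using opn by (simp add: open_P openin_Int)
      have "k \<in> ?B"
        using k(1) kc VW(3) by (simp add: topspace_eq)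
      then have "?f ` ?B \<inter> ?Q \<noteq> {}"
        using z k(2) by blast
      then have "?f ` V \<inter> ?f ` ?B \<noteq> {}"
        using almost_open_image_meets[OF _ _ continuous_map_into_orbit almost V(1) B]
          completely_metrizable_space_openin[OF compl opn] Hausdorff_space_subtopology[OF Haus]
        by blast
      then obtain v b where vb: "v \<in> V" "b \<in> ?B" "?f v = ?f b"
        by blast
      \<comment> \<open>The correction sends \<open>?f b = ?f v\<close> to \<open>?f k = z\<close>,
        so \<open>z\<close> is the value of the orbit map at
        \<open>k \<otimes> inv b \<otimes> v\<close>.\<close>
      have "m (k \<otimes> inv b) (?f v) = Some z"
        unfolding vb(3) k(2) using act_divide[OF m_f m_f] vb(2) k(1) by blast
      then have "m (k \<otimes> inv b \<otimes> v) x = Some z"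
        using PA2[OF m_f] vb(1) by (simp add: V_def)
      moreover have "k \<otimes> inv b \<otimes> v \<in> U"
        using VW(5) vb by (simp add: V_def)
      ultimately show "z \<in> ?f ` U"
        by (force simp: pa_act_def)
    qed
    ultimately show ?thesis
      using openin_interior_of by blast
  qed
  then show "openin ?Y (?f ` U)"
    by (subst openin_subopen) blast
qed

section \<open>The coset space\<close>

text \<open>The saturation of \<open>V \<inter> pa_at m x\<close> is the union of the open
  translates of \<open>V\<close> by stabilizer elements, cut down to
  \<open>pa_at m x\<close>.\<close>

lemma open_coset_map:
  "open_map (subtopology TG (pa_at m x)) (pa_coset_topology G TG m x) (\<lambda>g. g <# pa_stabilizer m x)"
  unfolding open_map_def
proof (intro allI impI)
  let ?P = "subtopology TG (pa_at m x)" and ?q = "\<lambda>g. g <# pa_stabilizer m x"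
  fix U assume U: "openin ?P U"
  obtain V where V: "openin TG V" "U = V \<inter> pa_at m x"
    using U by (auto simp: openin_subtopology)
  have stab: "s \<in> carrier G" "inv s \<in> pa_stabilizer m x" "m s x = Some x" if "s \<in> pa_stabilizer m x" for s
  proof -
    show s: "m s x = Some x"
      using that by (simp add: pa_stabilizer_def m_Some_iff_pa_act)
    show "s \<in> carrier G" "inv s \<in> pa_stabilizer m x"
      using defined_only[OF s] PA1[OF s] by (auto simp: pa_stabilizer_def m_Some_iff_pa_act)
  qed
  have "{g \<in> pa_at m x. ?q g \<in> ?q ` U} = (\<Union>s\<in>pa_stabilizer m x. (\<lambda>g. g \<otimes> s) ` V) \<inter> pa_at m x"
  proof (intro subset_antisym subsetI)
    fix g assume g: "g \<in> {g \<in> pa_at m x. ?q g \<in> ?q ` U}"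
    then obtain u where u: "u \<in> U" "?q g = ?q u"
      by blast
    have gx: "g \<in> carrier G" "x \<in> topspace TX"
      using g defined_only by (auto simp: pa_at_def)
    have "\<one> \<in> pa_stabilizer m x"
      using PA3[OF gx(2)] by (simp add: pa_stabilizer_def m_Some_iff_pa_act)
    then have "g \<otimes> \<one> \<in> ?q g"
      unfolding l_coset_def by blast
    then have "g \<in> ?q u"
      using gx(1) u(2) by simp
    then show "g \<in> (\<Union>s\<in>pa_stabilizer m x. (\<lambda>g. g \<otimes> s) ` V) \<inter> pa_at m x"
      using g u(1) V(2) by (auto simp: l_coset_def)
  next
    fix g assume "g \<in> (\<Union>s\<in>pa_stabilizer m x. (\<lambda>g. g \<otimes> s) ` V) \<inter> pa_at m x"
    then obtain s v where s: "s \<in> pa_stabilizer m x" and v: "v \<in> V" "g = v \<otimes> s" and g: "g \<in> pa_at m x"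
      by blast
    have vc: "v \<in> carrier G"
      using v(1) openin_subset[OF V(1)] by (auto simp: topspace_eq)
    \<comment> \<open>So far \<open>v\<close> is only known to lie in \<open>V\<close>. Since
      \<open>v = g \<otimes> inv s\<close> and \<open>inv s\<close> fixes \<open>x\<close>, it acts
      on \<open>x\<close> as \<open>g\<close> does.\<close>
    obtain y where "m g x = Some y"
      using g by (auto simp: pa_at_def)
    then have "m (g \<otimes> inv s) x = Some y"
      using PA2[OF PA1[OF stab(3)[OF s]]] by blast
    moreover have "g \<otimes> inv s = v"
      using vc stab(1)[OF s] v(2) by (simp add: m_assoc)
    ultimately have v_at: "v \<in> pa_at m x" and v_act: "pa_act m v x = pa_act m g x"
      using \<open>m g x = Some y\<close> by (auto simp: m_Some_iff_pa_act)
    have "?q v = ?q g"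
      by (rule inj_onD[OF inj_on_pa_orbit_map[of x]]) (use v_at g v_act in \<open>simp_all add: pa_orbit_map_coset\<close>)
    moreover have "v \<in> U"
      using v_at v(1) V(2) by blast
    ultimately show "g \<in> {g \<in> pa_at m x. ?q g \<in> ?q ` U}"
      using g by auto
  qed
  moreover have "openin TG (\<Union>s\<in>pa_stabilizer m x. (\<lambda>g. g \<otimes> s) ` V)"
    using openin_right_translate[OF V(1)] stab(1) by blast
  ultimately have "openin ?P {g \<in> pa_at m x. ?q g \<in> ?q ` U}"
    by (simp add: openin_subtopology_Int)
  moreover have "U \<subseteq> pa_at m x"
    using V(2) by blast
  ultimately show "openin (pa_coset_topology G TG m x) (?q ` U)"
    unfolding pa_coset_topology_def openin_quotient_topology topspace_subtopology topspace_Int_pa_at by blast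
qed

text \<open>The map on elements factors through the open quotient map onto cosets. Continuity and
  bijectivity of the induced map hold in any case, which leaves openness as the only
  condition.\<close>

lemma homeomorphic_map_pa_orbit_map_iff:
  "homeomorphic_map (pa_coset_topology G TG m x) (orbit_topology x) (pa_orbit_map G m x) \<longleftrightarrow>
   open_map (subtopology TG (pa_at m x)) (orbit_topology x) (\<lambda>g. pa_act m g x)"
  (is "homeomorphic_map ?C ?Y ?\<phi> \<longleftrightarrow> open_map ?P ?Y ?f")
proof -
  let ?q = "\<lambda>g. g <# pa_stabilizer m x"
  have comp: "(?\<phi> \<circ> ?q) g = ?f g" if "g \<in> pa_at m x" for g
    using that by (simp add: pa_orbit_map_coset)
  have quot: "quotient_map ?P ?C ?q"
    unfolding pa_coset_topology_def by (rule quotient_map_quotient_topology)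
  show ?thesis
  proof
    assume "homeomorphic_map ?C ?Y ?\<phi>"
    then have "open_map ?P ?Y (?\<phi> \<circ> ?q)"
      using open_coset_map homeomorphic_imp_open_map open_map_compose by blast
    then show "open_map ?P ?Y ?f"
      by (rule open_map_eq) (simp add: pa_orbit_map_coset)
  next
    assume op: "open_map ?P ?Y ?f"
    have topC: "topspace ?C = ?q ` pa_at m x"
      by (simp add: pa_coset_topology_def topspace_quotient_topology)
    show "homeomorphic_map ?C ?Y ?\<phi>"
    proof (rule bijective_open_imp_homeomorphic_map)
      show "continuous_map ?C ?Y ?\<phi>"
        by (rule continuous_compose_quotient_map[OF quot],
            rule continuous_map_eq[OF continuous_map_into_orbit]) (simp add: pa_orbit_map_coset)
      show "open_map ?C ?Y ?\<phi>"
        unfolding open_map_def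
      proof (intro allI impI)
        fix U assume U: "openin ?C U"
        then have "U \<subseteq> ?q ` pa_at m x" "openin ?P {g \<in> pa_at m x. ?q g \<in> U}"
          by (simp_all add: pa_coset_topology_def openin_quotient_topology)
        moreover from this(1) have "?\<phi> ` U = ?f ` {g \<in> pa_at m x. ?q g \<in> U}"
          using comp by force
        ultimately show "openin ?Y (?\<phi> ` U)"
          using op by (simp add: open_map_def)
      qed
      show "?\<phi> ` topspace ?C = topspace ?Y"
        unfolding topC topspace_subtopology topspace_Int_pa_orbit
        by (simp add: image_image pa_orbit_map_coset pa_orbit_def)
      show "inj_on ?\<phi> (topspace ?C)"
        unfolding topC by (rule inj_on_pa_orbit_map)
    qed
  qed
qed

end

section \<open>The implications between the three assertions\<close>

theorem theorem4p5:
  fixes G :: "('g, 'b) monoid_scheme" and TG :: "'g topology"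
    and TX :: "'x topology" and m :: "'g \<Rightarrow> 'x \<Rightarrow> 'x option" and x :: 'x
  assumes "polish_group G TG"
    and "polish_topology TX"
    and "continuous_partial_action G TG TX m"
    and "x \<in> topspace TX"
    and "gdelta_in TG (pa_at m x)"
    and "closedin TG (pa_stabilizer m x)"
  shows "(homeomorphic_map (pa_coset_topology G TG m x) (subtopology TX (pa_orbit m x))
             (pa_orbit_map G m x)
           \<longrightarrow> gdelta_in TX (pa_orbit m x))
       \<and> (gdelta_in TX (pa_orbit m x)
           \<longrightarrow> \<not> meager_in (subtopology TX (pa_orbit m x)) (pa_orbit m x))
       \<and> (openin TG (pa_at m x) \<longrightarrow>
           (homeomorphic_map (pa_coset_topology G TG m x) (subtopology TX (pa_orbit m x))
               (pa_orbit_map G m x)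
             \<longleftrightarrow> gdelta_in TX (pa_orbit m x))
         \<and> (gdelta_in TX (pa_orbit m x)
             \<longleftrightarrow> \<not> meager_in (subtopology TX (pa_orbit m x)) (pa_orbit m x)))"
proof -
  interpret continuous_partial_action G TG TX m by fact
  let ?P = "subtopology TG (pa_at m x)" and ?f = "\<lambda>g. pa_act m g x"
  let ?hom = "homeomorphic_map (pa_coset_topology G TG m x) (orbit_topology x) (pa_orbit_map G m x)"
  have TG: "separable_space TG" "completely_metrizable_space TG" "second_countable TG"
    using assms(1) polish_imp_second_countable by (auto simp: polish_group_def polish_topology_def)
  have TX: "completely_metrizable_space TX" "metrizable_space TX" "Hausdorff_space TX"
    using assms(2) completely_metrizable_imp_metrizable_space metrizable_imp_Hausdorff_space
    by (auto simp: polish_topology_def)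
  have orbit: "pa_orbit m x = ?f ` topspace ?P"
    by (simp add: pa_orbit_def)
  have 12: "gdelta_in TX (pa_orbit m x)" if "?hom"
  proof -
    have "open_map ?P (orbit_topology x) ?f"
      using that by (simp add: homeomorphic_map_pa_orbit_map_iff)
    \<comment> \<open>\<open>pa_at m x\<close> is completely metrizable as a G_delta subspace of
      \<open>TG\<close>, and it inherits a countable base.\<close>
    then show ?thesis
      unfolding orbit
      using completely_metrizable_space_gdelta_in[OF TG(2) assms(5)] second_countable_subtopology[OF TG(3)]
        TX(2) continuous_orbit_map
      by (intro gdelta_in_open_map_image) auto
  qed
  \<comment> \<open>Baire's theorem is applied to a nonempty space, as the empty set is
    meager.\<close>
  have "x \<in> pa_orbit m x"
    using PA3[OF assms(4)] by (auto simp: pa_orbit_eq)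
  then have 23: "\<not> meager_in (orbit_topology x) (pa_orbit m x)" if "gdelta_in TX (pa_orbit m x)"
    using not_meager_in_topspace[OF completely_metrizable_space_gdelta_in[OF TX(1) that]] by auto
  have 31: "?hom" if "\<not> meager_in (orbit_topology x) (pa_orbit m x)" "openin TG (pa_at m x)"
    unfolding homeomorphic_map_pa_orbit_map_iff
    using open_orbit_map[OF TG(1,2) TX(3) that(2) assms(4) that(1)] .
  show ?thesis
    using 12 23 31 by blast
qed

end
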